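(* Let $N=\{1,2,3\}$ and let $v:\mathcal{P}(N)\to\mathbb{R}$ be given by $v(C)=0$ if $|C|\le 1$, $v(C)=\tfrac12$ if $|C|=2$, and $v(N)=1$. Then $G=\langle N,v\rangle$ is an essential, non-constant-sum, convex three-player game whose abstract argumentation framework $\langle \mathrm{IMP},\to\rangle$ is not well-founded.
   Context: A cooperative game is a pair $\langle N,v\rangle$ with $N=\{1,\dots,m\}$ and $v:\mathcal{P}(N)\to\mathbb{R}$, $v(\varnothing)=0$. It is essential if $\sum_{k\in N} v(\{k\})\neq v(N)$; constant-sum if $v(C)+v(N\setminus C)=v(N)$ for all $C\subseteq N$; convex if $v(C\cup C')+v(C\cap C')\ge v(C)+v(C')$ for all $C,C'\subseteq N$. An imputation is a vector $\mathbf{x}=(x_1,\dots,x_m)\in\mathbb{R}^m$ with $\sum_{k\in N}x_k=v(N)$ and $x_k\ge v(\{k\})$ for all $k\in N$; $\mathrm{IMP}$ denotes the set of imputations. For $C\subseteq N$ and $\mathbf{x},\mathbf{y}\in \mathrm{IMP}$, write $\mathbf{x}\to_C\mathbf{y}$ iff $x_k>y_k$ for all $k\in C$ and $\sum_{k\in C}x_k\le v(C)$. Write $\mathbf{x}\to\mathbf{y}$ iff $\mathbf{x}\to_C\mathbf{y}$ for some nonempty $C\subseteq N$. The directed graph $\langle \mathrm{IMP},\to\rangle$ is viewed as an abstract argumentation framework, with imputations as arguments and $\to$ as attack relation. An abstract argumentation framework $\langle A,R\rangle$ (a set $A$ with $R\subseteq A^2$) is well-founded iff there is no sequence $(a^i)_{i\in\mathbb{N}}$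 in $A$ with $R(a^{i+1},a^i)$ for all $i\in\mathbb{N}$. *)

theory Defs
  imports Complex_Main "HOL-Library.FuncSet"
begin

(* A game is given by its player set N and a function v on sets of naturals; the values of v
   at sets that are not subsets of N are irrelevant to every notion below. *)

definition cooperative_game :: "nat set \<Rightarrow> (nat set \<Rightarrow> real) \<Rightarrow> bool" where
  "cooperative_game N v \<longleftrightarrow> (\<exists>m. N = {1..m}) \<and> v {} = 0"

definition essential :: "nat set \<Rightarrow> (nat set \<Rightarrow> real) \<Rightarrow> bool" where
  "essential N v \<longleftrightarrow> (\<Sum>k\<in>N. v {k}) \<noteq> v N"

definition constant_sum :: "nat set \<Rightarrow> (nat set \<Rightarrow> real) \<Rightarrow> bool" where
  "constant_sum N v \<longleftrightarrow> (\<forall>C\<subseteq>N. v C + v (N - C) = v N)"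

definition convex_game :: "nat set \<Rightarrow> (nat set \<Rightarrow> real) \<Rightarrow> bool" where
  "convex_game N v \<longleftrightarrow> (\<forall>C\<subseteq>N. \<forall>C'\<subseteq>N. v (C \<union> C') + v (C \<inter> C') \<ge> v C + v C')"

(* Payoff vectors indexed by N are functions on N; extensionality fixes their value off N,
   so that equality of imputations is equality of vectors. *)
definition IMP :: "nat set \<Rightarrow> (nat set \<Rightarrow> real) \<Rightarrow> (nat \<Rightarrow> real) set" where
  "IMP N v = {x \<in> N \<rightarrow>\<^sub>E UNIV. (\<Sum>k\<in>N. x k) = v N \<and> (\<forall>k\<in>N. x k \<ge> v {k})}"

definition dominates_via ::
    "(nat set \<Rightarrow> real) \<Rightarrow> nat set \<Rightarrow> (nat \<Rightarrow> real) \<Rightarrow> (nat \<Rightarrow> real) \<Rightarrow> bool" where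
  "dominates_via v C x y \<longleftrightarrow> (\<forall>k\<in>C. x k > y k) \<and> (\<Sum>k\<in>C. x k) \<le> v C"

(* A pair (x, y) means that x attacks y. *)
definition attacks :: "nat set \<Rightarrow> (nat set \<Rightarrow> real) \<Rightarrow> ((nat \<Rightarrow> real) \<times> (nat \<Rightarrow> real)) set" where
  "attacks N v = {(x, y). x \<in> IMP N v \<and> y \<in> IMP N v \<and>
     (\<exists>C. C \<subseteq> N \<and> C \<noteq> {} \<and> dominates_via v C x y)}"

definition well_founded_af :: "'a set \<Rightarrow> ('a \<times> 'a) set \<Rightarrow> bool" where
  "well_founded_af A R \<longleftrightarrow>
     \<not> (\<exists>a :: nat \<Rightarrow> 'a. (\<forall>i. a i \<in> A) \<and> (\<forall>i. (a (Suc i), a i) \<in> R))"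

end

theory Submission
  imports Defs
begin

text \<open>The game is \<open>v C = max 0 ((card C - 1) / 2)\<close>, a convex function of the cardinality, hence convex.
  The payoffs \<open>(t, t, 1 - 2t)\<close> with \<open>t\<close> strictly increasing in \<open>[0, 1/4]\<close> form an
  infinite chain in which each imputation is attacked by its successor via the coalition \<open>{1, 2}\<close>.\<close>

theorem theorem11:
  fixes N :: "nat set" and v :: "nat set \<Rightarrow> real"
  assumes "N = {1, 2, 3}"
    and "\<And>C. C \<subseteq> N \<Longrightarrow> card C \<le> 1 \<Longrightarrow> v C = 0"
    and "\<And>C. C \<subseteq> N \<Longrightarrow> card C = 2 \<Longrightarrow> v C = 1 / 2"
    and "v N = 1"
  shows "cooperative_game N v \<and> card N = 3 \<and> essential N v \<and> \<not> constant_sum N v \<and>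
    convex_game N v \<and> \<not> well_founded_af (IMP N v) (attacks N v)"
proof (intro conjI)
  have fin: "finite N" and card_N: "card N = 3"
    using assms(1) by auto
  \<comment> \<open>The maximum matters only for the empty set, where the real quotient is -1/2; at
    cardinalities 1, 2, 3 the quotient itself is 0, 1/2, 1.\<close>
  have v_card: "v C = max 0 ((real (card C) - 1) / 2)" if "C \<subseteq> N" for C
  proof -
    have "card C \<le> 3"
      using card_mono[OF fin that] card_N by simp
    then consider "card C \<le> 1" | "card C = 2" | "card C = 3" by linarith
    then show ?thesis
    proof cases
      case 3
      then have "C = N"
        using card_subset_eq[OF fin that] card_N by simp
      then show ?thesis
        using assms(4) card_N by simp
    qed (use assms(2,3) that in auto)
  qed
  have v_single: "v {k} = 0" if "k \<in> N" for k
    using assms(2) that by simp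
  have N_interval: "N = {1..3}"
    using assms(1) by auto
  show "cooperative_game N v"
    unfolding cooperative_game_def using N_interval assms(2)[of "{}"] by auto
  show "card N = 3" by (fact card_N)
  show "essential N v"
    unfolding essential_def using v_single assms(4) by simp
  show "\<not> constant_sum N v"
  proof
    assume "constant_sum N v"
    \<comment> \<open>A singleton and its complementary pair are worth only 0 + 1/2 together, short
      of 1.\<close>
    then have "v {1} + v (N - {1}) = v N"
      unfolding constant_sum_def using assms(1) by blast
    moreover have "v (N - {1}) = 1 / 2"
      using assms(1) by (intro assms(3)) auto
    ultimately show False
      using v_single[of 1] assms(1,4) by simp
  qed
  show "convex_game N v"
    unfolding convex_game_def
  proof (intro allI impI)
    fix C C' assume sub: "C \<subseteq> N" "C' \<subseteq> N"
    then have finC: "finite C" "finite C'"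
      using fin finite_subset by auto
    have card_eq: "real (card (C \<union> C')) + card (C \<inter> C') = real (card C) + card C'"
      using card_Un_Int[OF finC] by linarith
    have vs: "v C = max 0 ((real (card C) - 1) / 2)" "v C' = max 0 ((real (card C') - 1) / 2)"
      "v (C \<union> C') = max 0 ((real (card (C \<union> C')) - 1) / 2)"
      "v (C \<inter> C') = max 0 ((real (card (C \<inter> C')) - 1) / 2)"
      using sub by (auto intro!: v_card)
    \<comment> \<open>With \<open>card_eq\<close>, these bounds place both \<open>card C\<close> and
      \<open>card C'\<close> between the cardinalities of the intersection and the union. The two
      pairs have equal sums, so a convex function has the larger total on the outer pair.\<close>
    have "card (C \<inter> C') \<le> card C" "card (C \<inter> C') \<le> card C'"
      using finC by (auto intro: card_mono)
    then show "v C + v C' \<le> v (C \<union> C') + v (C \<inter> C')"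
      unfolding vs using card_eq by (simp add: max_def field_simps)
  qed
  \<comment> \<open>The sequence starts at 0 and tends to 1/4 without reaching it. The ceiling 1/4
    is what feasibility for \<open>{1, 2}\<close> demands: 2t must not exceed the pair's worth 1/2.
    It also keeps player 3's share at least 1/2.\<close>
  define t :: "nat \<Rightarrow> real" where "t i = 1 / 4 - 1 / (4 * (real i + 1))" for i
  \<comment> \<open>Restricting to \<open>N\<close> gives the extensionality that \<open>IMP\<close>
    requires.\<close>
  define a where "a i = (\<lambda>k\<in>N. if k = 3 then 1 - 2 * t i else t i)" for i
  have t_bounds: "0 \<le> t i" "t i \<le> 1 / 4" for i
    unfolding t_def by (auto simp: field_simps)
  have t_less: "t i < t (Suc i)" for i
    unfolding t_def by (simp add: frac_less2)
  have a_IMP: "a i \<in> IMP N v" for i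
    unfolding IMP_def using t_bounds[of i] v_single assms(1,4) by (auto simp: a_def)
  have "(a (Suc i), a i) \<in> attacks N v" for i
  proof -
    have "dominates_via v {1, 2} (a (Suc i)) (a i)"
      using t_less[of i] t_bounds[of "Suc i"] assms(1) assms(3)[of "{1, 2}"]
      by (auto simp: dominates_via_def a_def)
    moreover have "{1, 2} \<subseteq> N" "{1, 2} \<noteq> ({} :: nat set)"
      using assms(1) by auto
    ultimately show ?thesis
      unfolding attacks_def using a_IMP by blast
  qed
  then show "\<not> well_founded_af (IMP N v) (attacks N v)"
    unfolding well_founded_af_def using a_IMP by blast
qed

end
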